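(* Let $n_1,n_2,n_3,k\in\mathbb{N}$. If $k\ge 3$, then $P_{n_1}\square P_{n_2}\square P_{n_3}$ is equitably $k$-list arborable.
   Context: $\mathbb{N}$ is the set of positive integers. $P_n$ denotes the path on $n$ vertices and $\square$ the Cartesian product. A $k$-uniform list assignment $L$ for $G$ assigns to each vertex $v$ a set $L(v)$ of exactly $k$ colours; an $L$-colouring is a map $c$ with $c(v)\in L(v)$; it is equitable if every colour class has at most $\lceil |V(G)|/k\rceil$ vertices. $G$ is equitably $k$-list arborable if for every $k$-uniform list assignment $L$ there is an equitable $L$-colouring of $G$ in which every colour class induces an acyclic subgraph. *)

theory Defs
  imports Complex_Main "Graph_Theory.Graph_Theory"
begin

text \<open>
  A finite simple graph is a finite, symmetric, loop-free digraph without parallel arcs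
  (locale \<^locale>\<open>pair_graph\<close>); an edge is represented by its two orientations.
\<close>

definition path_graph :: "nat \<Rightarrow> nat pair_pre_digraph" where
  "path_graph n = \<lparr>pverts = {1..n},
     parcs = {(i, j). i \<in> {1..n} \<and> j \<in> {1..n} \<and> (j = i + 1 \<or> i = j + 1)}\<rparr>"

definition cartesian_product ::
  "'a pair_pre_digraph \<Rightarrow> 'b pair_pre_digraph \<Rightarrow> ('a \<times> 'b) pair_pre_digraph"
  (infixl \<open>\<box>\<close> 70) where
  "G \<box> H = \<lparr>pverts = pverts G \<times> pverts H,
     parcs = {((u, v), (u', v')). u = u' \<and> u \<in> pverts G \<and> (v, v') \<in> parcs H \<or>
                                  v = v' \<and> v \<in> pverts H \<and> (u, u') \<in> parcs G}\<rparr>"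

lemma pair_graph_path_graph: "pair_graph (path_graph n)"
  by unfold_locales (auto simp: path_graph_def symmetric_def sym_def
    intro: finite_subset[of _ "{1..n} \<times> {1..n}"])

lemma pair_graph_cartesian_product:
  assumes "pair_graph G" "pair_graph H"
  shows "pair_graph (G \<box> H)"
proof -
  interpret G: pair_graph G by fact
  interpret H: pair_graph H by fact
  have "parcs (G \<box> H) \<subseteq> (pverts G \<times> pverts H) \<times> (pverts G \<times> pverts H)"
    by (auto simp: cartesian_product_def dest: G.wellformed' H.wellformed')
  moreover have "finite (pverts (G \<box> H))"
    by (simp add: cartesian_product_def G.pair_finite_verts H.pair_finite_verts)
  moreover have "symmetric (with_proj (G \<box> H))"
    using G.pair_sym_arcs H.pair_sym_arcs
    by (auto simp: symmetric_def sym_def cartesian_product_def)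
  ultimately show ?thesis
    by unfold_locales
      (auto simp: cartesian_product_def G.pair_finite_verts H.pair_finite_verts
        dest: G.wellformed' H.wellformed' G.no_loops' H.no_loops' intro: finite_subset)
qed

text \<open>
  In a symmetric digraph \<^const>\<open>pre_digraph.cycle\<close> also accepts the closed walk \<open>u, v, u\<close> that
  traverses one edge back and forth. The closed walks it accepts that have length at least 3 are
  exactly the cycles of the underlying simple graph; hence \<^const>\<open>forest\<close> is not the right notion.
\<close>

definition acyclic_graph :: "('a, 'a \<times> 'a) pre_digraph \<Rightarrow> bool" where
  "acyclic_graph G \<longleftrightarrow> \<not> (\<exists>p. pre_digraph.cycle G p \<and> 3 \<le> length p)"

definition uniform_list_assignment ::
  "nat \<Rightarrow> 'a pair_pre_digraph \<Rightarrow> ('a \<Rightarrow> 'c set) \<Rightarrow> bool" where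
  "uniform_list_assignment k G L \<longleftrightarrow> (\<forall>v \<in> pverts G. finite (L v) \<and> card (L v) = k)"

definition list_colouring ::
  "'a pair_pre_digraph \<Rightarrow> ('a \<Rightarrow> 'c set) \<Rightarrow> ('a \<Rightarrow> 'c) \<Rightarrow> bool" where
  "list_colouring G L c \<longleftrightarrow> (\<forall>v \<in> pverts G. c v \<in> L v)"

definition colour_class :: "'a pair_pre_digraph \<Rightarrow> ('a \<Rightarrow> 'c) \<Rightarrow> 'c \<Rightarrow> 'a set" where
  "colour_class G c x = {v \<in> pverts G. c v = x}"

definition equitable :: "nat \<Rightarrow> 'a pair_pre_digraph \<Rightarrow> ('a \<Rightarrow> 'c) \<Rightarrow> bool" where
  "equitable k G c \<longleftrightarrow>
     (\<forall>x. int (card (colour_class G c x)) \<le> \<lceil>real (card (pverts G)) / real k\<rceil>)"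

text \<open>
  HOL cannot quantify over types inside a formula, so the type of colours is a parameter. A theorem
  stated for \<open>TYPE('c)\<close> with a type variable \<open>'c\<close> covers lists of colours of every type.
\<close>

definition equitably_list_arborable :: "'c itself \<Rightarrow> nat \<Rightarrow> 'a pair_pre_digraph \<Rightarrow> bool" where
  "equitably_list_arborable (_ :: 'c itself) k G \<longleftrightarrow>
     (\<forall>L :: 'a \<Rightarrow> 'c set. uniform_list_assignment k G L \<longrightarrow>
        (\<exists>c. list_colouring G L c \<and> equitable k G c \<and>
             (\<forall>x. acyclic_graph (with_proj G \<restriction> colour_class G c x))))"

end

theory Submission
  imports Defs "HOL-Library.Product_Lexorder"
begin

text \<open>
  More generally, every finite set \<open>W\<close> of grid points with \<open>card W \<le> m * k\<close> has an \<open>L\<close>-colouring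
  with acyclic colour classes of size at most \<open>m\<close>; induction on \<open>m\<close>. Remove a set \<open>S\<close> of \<open>k\<close>
  points, colour the rest, and colour \<open>S\<close> greedily with pairwise distinct colours, where a point
  avoids the colours occurring at least twice among its neighbours outside \<open>S\<close>. Each class then
  grows by at most one vertex, which has at most one neighbour in the class, so no cycle arises.
  The greedy step works if the last three points of \<open>S\<close> to be coloured have at most 5, 3 and 1
  neighbours outside \<open>S\<close>. Let \<open>v = (a, b, c)\<close> be the lexicographically largest point of \<open>W\<close>. The
  last point is \<open>v\<close>; the other two are \<open>(a, b - 1, c)\<close> (if present, otherwise a largest remaining
  point) and the largest point of the rest, which is \<open>(a, b, c - 1)\<close> if that belongs to \<open>W\<close>. A
  largest point has at most three neighbours below it.
\<close>

section \<open>Acyclic induced subgraphs\<close>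

lemma pawalk_verts_eq: "pcas u p v \<Longrightarrow> pawalk_verts u p = u # map snd p"
  by (induction p arbitrary: u) auto

lemma pcas_snoc2: "pcas u (p @ [e, f]) v \<Longrightarrow> snd e = fst f \<and> snd f = v"
  by (induction p arbitrary: u) auto

text \<open>Brings the induced subgraph into the form of a pair digraph, so that the walk lemmas of
  \<open>pair_wf_digraph\<close> become available through
  \<open>pair_wf_digraph_restrict\<close>.\<close>

lemma induce_subgraph_with_proj:
  "with_proj G \<restriction> A = with_proj \<lparr>pverts = A, parcs = {e \<in> parcs G. fst e \<in> A \<and> snd e \<in> A}\<rparr>"
  by (auto simp: induce_subgraph_def with_proj_def)

lemma pair_wf_digraph_restrict:
  "pair_wf_digraph \<lparr>pverts = A, parcs = {e \<in> E. fst e \<in> A \<and> snd e \<in> A}\<rparr>"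
  by unfold_locales auto

lemma acyclic_graph_empty: "acyclic_graph (with_proj G \<restriction> {})"
  by (auto simp: acyclic_graph_def pre_digraph.cycle_def pre_digraph.awalk_def)

text \<open>A cycle avoiding \<open>x\<close> already lies in \<open>A\<close>. A cycle of length at
  least 3 through \<open>x\<close> leaves and enters it by two different neighbours in
  \<open>A\<close>, which \<open>nbr\<close> forbids.\<close>

lemma acyclic_graph_insert:
  assumes sym: "sym (parcs G)" and loop: "(x, x) \<notin> parcs G"
    and acyclic: "acyclic_graph (with_proj G \<restriction> A)"
    and nbr: "\<And>y z. y \<in> A \<Longrightarrow> z \<in> A \<Longrightarrow> (x, y) \<in> parcs G \<Longrightarrow> (x, z) \<in> parcs G \<Longrightarrow> y = z"
  shows "acyclic_graph (with_proj G \<restriction> insert x A)"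
proof (rule ccontr)
  define B where "B = insert x A"
  let ?E = "\<lambda>A. {e \<in> parcs G. fst e \<in> A \<and> snd e \<in> A}"
  let ?H = "\<lambda>A. \<lparr>pverts = A, parcs = ?E A\<rparr>"
  interpret H: pair_wf_digraph "?H (B)" by (rule pair_wf_digraph_restrict)
  interpret K: pair_wf_digraph "?H A" by (rule pair_wf_digraph_restrict)
  assume "\<not> ?thesis"
  then obtain p where "H.cycle p" and len: "3 \<le> length p"
    by (auto simp: acyclic_graph_def induce_subgraph_with_proj B_def[symmetric])
  then obtain u where walk: "H.awalk u p u" and dist: "distinct (tl (pawalk_verts u p))"
    by (auto simp: H.cycle_def)
  have p: "u \<in> B" "set p \<subseteq> ?E B" "pcas u p u"
    using walk by (auto simp: H.awalk_def)
  \<comment> \<open>The tail of the vertex list is the list of heads of the arcs; in this form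
    distinctness survives rotating the closed walk.\<close>
  have distinct: "distinct (map snd p)"
    using dist p(3) by (simp add: pawalk_verts_eq)
  show False
  proof (cases "x \<in> set (pawalk_verts u p)")
    case False
    then have "x \<notin> set (map fst p) \<union> set (map snd p)" "u \<noteq> x"
      using H.set_awalk_verts[OF walk] by auto
    then have "u \<in> A" "\<And>e. e \<in> set p \<Longrightarrow> fst e \<noteq> x \<and> snd e \<noteq> x"
      using p(1) by (auto simp: B_def)
    then have "set p \<subseteq> ?E A"
      using p(2) by (auto simp: B_def subset_iff)
    then have "K.awalk u p u"
      using \<open>u \<in> A\<close> p(3) by (simp add: K.awalk_def)
    then have "K.cycle p"
      using dist len by (auto simp: K.cycle_def)
    then show False
      using acyclic len by (auto simp: acyclic_graph_def induce_subgraph_with_proj)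
  next
    case True
    \<comment> \<open>Rotated to start at \<open>x\<close>, the walk leaves \<open>x\<close> by its
      first arc \<open>e\<close> and returns by its last arc \<open>g\<close>. By length at least 3,
      the arc \<open>f\<close> before \<open>g\<close> is not \<open>e\<close>, so
      \<open>snd e = fst g = snd f\<close> would repeat a head.\<close>
    then obtain q r where "p = q @ r" and rot: "H.awalk x (r @ q) x"
      using H.rotate_awalkE[OF walk True] by blast
    define s where "s = r @ q"
    have "length s = length p" "set s = set p"
      by (auto simp: s_def \<open>p = q @ r\<close>)
    have s_distinct: "distinct (map snd s)"
      using distinct by (auto simp: s_def \<open>p = q @ r\<close>)
    obtain e s' where "s = e # s'" "2 \<le> length s'"
      using len \<open>length s = length p\<close> by (cases s) auto
    moreover obtain g s'' where "s' = s'' @ [g]" "1 \<le> length s''"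
      using \<open>2 \<le> length s'\<close> by (cases s' rule: rev_cases) auto
    moreover obtain f m where "s'' = m @ [f]"
      using \<open>1 \<le> length s''\<close> by (cases s'' rule: rev_cases) auto
    ultimately have s: "s = e # m @ [f, g]"
      by simp
    have "pcas x s x"
      using rot unfolding H.awalk_def s_def by blast
    then have "fst e = x" "pcas (snd e) (m @ [f, g]) x"
      by (simp_all add: s)
    moreover from pcas_snoc2[OF this(2)] have "snd f = fst g" "snd g = x"
      by simp_all
    ultimately have ends: "fst e = x" "snd f = fst g" "snd g = x"
      by simp_all
    have "set s \<subseteq> ?E B"
      using p(2) \<open>set s = set p\<close> by simp
    then have "e \<in> ?E B" "g \<in> ?E B"
      by (simp_all add: s)
    moreover have "(x, snd e) = e" "(fst g, x) = g"
      using ends by (simp_all add: prod_eq_iff)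
    ultimately have "(x, snd e) \<in> parcs G" "(fst g, x) \<in> parcs G" "snd e \<in> B" "fst g \<in> B"
      by simp_all
    moreover from this have "(x, fst g) \<in> parcs G"
      using sym by (auto dest: symD)
    ultimately have "snd e = fst g"
      using nbr[of "snd e" "fst g"] loop by (auto simp: B_def)
    then show False
      using s_distinct ends by (simp add: s)
  qed
qed

section \<open>Extending a colouring\<close>

text \<open>Greedy choice in the order of \<open>xs\<close>: at position \<open>i\<close> at most
  \<open>i\<close> values are taken, and the set there has more than \<open>i\<close>
  elements.\<close>

lemma distinct_representatives:
  assumes "distinct xs" and "\<And>i. i < length xs \<Longrightarrow> finite (B (xs ! i)) \<and> i < card (B (xs ! i))"
  shows "\<exists>f. inj_on f (set xs) \<and> (\<forall>x \<in> set xs. f x \<in> B x)"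
  using assms
proof (induction xs rule: rev_induct)
  case (snoc x xs)
  have "finite (B (xs ! i)) \<and> i < card (B (xs ! i))" if "i < length xs" for i
    using snoc.prems(2)[of i] that by (simp add: nth_append)
  then obtain f where f: "inj_on f (set xs)" "\<forall>x \<in> set xs. f x \<in> B x"
    using snoc by auto
  have "card (f ` set xs) < card (B x)"
    using snoc.prems(2)[of "length xs"] card_image_le[of "set xs" f] card_length[of xs] by simp
  then obtain b where "b \<in> B x" "b \<notin> f ` set xs"
    by (metis List.finite_set card_mono finite_imageI linorder_not_less subsetI)
  then have "inj_on (f(x := b)) (set (xs @ [x])) \<and> (\<forall>y \<in> set (xs @ [x]). (f(x := b)) y \<in> B y)"
    using f snoc.prems(1) by (auto simp: inj_on_def)
  then show ?case by blast
qed simp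

text \<open>The fibres of \<open>c\<close> over \<open>F\<close> are disjoint subsets of
  \<open>A\<close> with at least two elements each. This bounds the number of forbidden colours by
  half the number of coloured neighbours.\<close>

lemma card_repeated_values:
  assumes "finite A" and F: "F = {z. 2 \<le> card {y \<in> A. c y = z}}"
  shows "finite F \<and> 2 * card F \<le> card A"
proof -
  have "F \<subseteq> c ` A"
  proof
    fix z
    assume "z \<in> F"
    then have "{y \<in> A. c y = z} \<noteq> {}"
      unfolding F by (metis card.empty mem_Collect_eq not_numeral_le_zero)
    then show "z \<in> c ` A" by auto
  qed
  then have fin: "finite F"
    using \<open>finite A\<close> finite_surj by blast
  have "2 * card F \<le> (\<Sum>z\<in>F. card {y \<in> A. c y = z})"
    using sum_mono[of F "\<lambda>_. 2" "\<lambda>z. card {y \<in> A. c y = z}"] by (simp add: F)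
  also have "\<dots> = card (\<Union>z\<in>F. {y \<in> A. c y = z})"
    using fin \<open>finite A\<close> by (subst card_UN_disjoint) auto
  also have "\<dots> \<le> card A"
    using \<open>finite A\<close> by (intro card_mono) auto
  finally show ?thesis
    using fin by simp
qed

text \<open>The vertex set \<open>W\<close> and the bound \<open>m\<close> are left free for the
  induction; the target is the case where \<open>W\<close> is all of \<open>pverts G\<close> and
  \<open>m\<close> is the ceiling.\<close>

definition balanced_colouring ::
  "'a pair_pre_digraph \<Rightarrow> ('a \<Rightarrow> 'c set) \<Rightarrow> nat \<Rightarrow> 'a set \<Rightarrow> ('a \<Rightarrow> 'c) \<Rightarrow> bool" where
  "balanced_colouring G L m W c \<longleftrightarrow>
     (\<forall>v \<in> W. c v \<in> L v) \<and> (\<forall>z. card {v \<in> W. c v = z} \<le> m) \<and>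
     (\<forall>z. acyclic_graph (with_proj G \<restriction> {v \<in> W. c v = z}))"

lemma balanced_colouring_empty: "balanced_colouring G L m {} c"
  by (simp add: balanced_colouring_def acyclic_graph_empty)

text \<open>Half the neighbours outside the list bound the forbidden colours, so \<open>nbrs\<close>
  says, in doubled form, that more than \<open>i\<close> of the \<open>k\<close> colours stay
  available for \<open>xs ! i\<close>.\<close>

lemma balanced_colouring_extend:
  assumes sym: "sym (parcs G)" and irrefl: "irrefl (parcs G)" and fin: "finite W"
    and L: "\<And>v. v \<in> W \<Longrightarrow> finite (L v) \<and> card (L v) = k"
    and xs: "distinct xs" "set xs \<subseteq> W"
    and nbrs: "\<And>i. i < length xs \<Longrightarrow>
      2 * i + card {y \<in> W - set xs. (xs ! i, y) \<in> parcs G} < 2 * k"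
    and c: "balanced_colouring G L m (W - set xs) c"
  shows "\<exists>c'. balanced_colouring G L (Suc m) W c'"
proof -
  define N where "N x = {y \<in> W - set xs. (x, y) \<in> parcs G}" for x
  define F where "F x = {z. 2 \<le> card {y \<in> N x. c y = z}}" for x
  have finN: "finite (N x)" for x
    using fin by (simp add: N_def)
  have F: "finite (F x) \<and> 2 * card (F x) \<le> card (N x)" for x
    using card_repeated_values[OF finN F_def] .
  have "finite (L (xs ! i) - F (xs ! i)) \<and> i < card (L (xs ! i) - F (xs ! i))"
    if i: "i < length xs" for i
  proof -
    have "xs ! i \<in> W"
      using i xs(2) by auto
    then show ?thesis
      using L[of "xs ! i"] F[of "xs ! i"] nbrs[OF i, folded N_def]
        diff_card_le_card_Diff[of "F (xs ! i)" "L (xs ! i)"]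
      by auto
  qed
  from distinct_representatives[OF xs(1), where B = "\<lambda>x. L x - F x", OF this]
  obtain f where inj: "inj_on f (set xs)" and f: "\<And>x. x \<in> set xs \<Longrightarrow> f x \<in> L x - F x"
    by blast
  define c' where "c' x = (if x \<in> set xs then f x else c x)" for x
  let ?old = "\<lambda>z. {v \<in> W - set xs. c v = z}"
  have classes: "{v \<in> W. c' v = z} = ?old z \<union> {x \<in> set xs. f x = z}" for z
    using xs(2) by (auto simp: c'_def)
  \<comment> \<open>The new colours are pairwise distinct, so each class gains at most one
    vertex.\<close>
  have new: "{x \<in> set xs. f x = z} = {} \<or> (\<exists>x \<in> set xs. {x \<in> set xs. f x = z} = {x} \<and> f x = z)"
    for z
  proof (cases "z \<in> f ` set xs")
    case True
    then obtain x where "x \<in> set xs" "f x = z" by blast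
    moreover from this have "{x \<in> set xs. f x = z} = {x}"
      using inj by (auto dest: inj_onD)
    ultimately show ?thesis by blast
  qed auto
  have "card {v \<in> W. c' v = z} \<le> Suc m \<and> acyclic_graph (with_proj G \<restriction> {v \<in> W. c' v = z})" for z
    using new[of z]
  proof
    assume "{x \<in> set xs. f x = z} = {}"
    then have "{v \<in> W. c' v = z} = ?old z"
      using classes[of z] by auto
    then show ?thesis
      using c by (simp add: balanced_colouring_def le_SucI)
  next
    assume "\<exists>x \<in> set xs. {x \<in> set xs. f x = z} = {x} \<and> f x = z"
    then obtain x where x: "x \<in> set xs" "{x \<in> set xs. f x = z} = {x}" "f x = z"
      by blast
    then have eq: "{v \<in> W. c' v = z} = insert x (?old z)"
      using classes[of z] by auto
    \<comment> \<open>A colour outside \<open>F x\<close> occurs on at most one neighbour of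
      \<open>x\<close> outside the list, as \<open>acyclic_graph_insert\<close> requires.\<close>
    have "z \<notin> F x"
      using f[OF x(1)] x(3) by auto
    then have "card {y \<in> N x. c y = z} \<le> 1"
      by (simp add: F_def)
    then have one: "\<forall>y \<in> {y \<in> N x. c y = z}. \<forall>y' \<in> {y \<in> N x. c y = z}. y = y'"
      using finN by (subst (asm) One_nat_def, subst (asm) card_le_Suc0_iff_eq) auto
    have "acyclic_graph (with_proj G \<restriction> insert x (?old z))"
    proof (rule acyclic_graph_insert[OF sym])
      show "(x, x) \<notin> parcs G"
        using irrefl by (simp add: irrefl_def)
      show "acyclic_graph (with_proj G \<restriction> ?old z)"
        using c by (simp add: balanced_colouring_def)
    qed (use one in \<open>auto simp: N_def\<close>)
    moreover have "card (?old z) \<le> m"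
      using c by (simp add: balanced_colouring_def)
    ultimately show ?thesis
      unfolding eq using card_insert_le_m1[of "Suc m" "?old z" x] by simp
  qed
  moreover have "\<forall>v \<in> W. c' v \<in> L v"
    using c f by (auto simp: c'_def balanced_colouring_def)
  ultimately have "balanced_colouring G L (Suc m) W c'"
    by (simp add: balanced_colouring_def)
  then show ?thesis by blast
qed

text \<open>Position \<open>i\<close> tolerates fewer than \<open>2 * (k - i)\<close> neighbours
  outside the list. Up to position \<open>k - 4\<close> degree 6 is harmless; the last three
  positions give the bounds 6, 4 and 2. Arbitrary vertices fill the front, which only lowers the
  counts for the triple.\<close>

lemma removable_list_of_triple:
  assumes fin: "finite W" and "3 \<le> k" "k \<le> card W"
    and deg: "\<And>A x. card {y \<in> A. (x, y) \<in> E} \<le> 6"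
    and x: "x1 \<in> W" "x2 \<in> W" "x3 \<in> W" "distinct [x1, x2, x3]"
    and nbrs: "card {y \<in> W - {x1, x2, x3}. (x1, y) \<in> E} < 2"
      "card {y \<in> W - {x1, x2, x3}. (x2, y) \<in> E} < 4"
      "card {y \<in> W - {x1, x2, x3}. (x3, y) \<in> E} < 6"
  shows "\<exists>xs. distinct xs \<and> set xs \<subseteq> W \<and> length xs = k \<and>
    (\<forall>i < k. 2 * i + card {y \<in> W - set xs. (xs ! i, y) \<in> E} < 2 * k)"
proof -
  have "card (W - {x1, x2, x3}) = card W - 3"
    using x by (subst card_Diff_subset) auto
  then have "k - 3 \<le> card (W - {x1, x2, x3})"
    using \<open>k \<le> card W\<close> by simp
  then obtain T where T: "T \<subseteq> W - {x1, x2, x3}" "card T = k - 3"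
    by (rule obtain_subset_with_card_n)
  then obtain ys where ys: "set ys = T" "distinct ys"
    using finite_distinct_list[of T] fin finite_subset[of T W] by blast
  define xs where "xs = ys @ [x3, x2, x1]"
  have len: "length ys = k - 3"
    using ys T distinct_card by metis
  have nbrs': "card {y \<in> W - set xs. (z, y) \<in> E} \<le> card {y \<in> W - {x1, x2, x3}. (z, y) \<in> E}" for z
    using fin by (intro card_mono) (auto simp: xs_def)
  have "2 * i + card {y \<in> W - set xs. (xs ! i, y) \<in> E} < 2 * k" if "i < k" for i
  proof -
    consider "i < k - 3" | "i = k - 3" | "i = k - 2" | "i = k - 1"
      using \<open>i < k\<close> \<open>3 \<le> k\<close> by linarith
    then show ?thesis
    proof cases
      case 1
      then show ?thesis
        using deg[of "W - set xs" "xs ! i"] by simp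
    next
      case 2
      then have "xs ! i = x3"
        by (simp add: xs_def nth_append len)
      then show ?thesis
        using 2 nbrs(3) nbrs'[of x3] \<open>3 \<le> k\<close> by simp
    next
      case 3
      then have "i = length ys + 1"
        using len \<open>3 \<le> k\<close> by simp
      then have "xs ! i = x2"
        by (simp add: xs_def nth_append)
      then show ?thesis
        using 3 nbrs(2) nbrs'[of x2] \<open>3 \<le> k\<close> by simp
    next
      case 4
      then have "i = length ys + 2"
        using len \<open>3 \<le> k\<close> by simp
      then have "xs ! i = x1"
        by (simp add: xs_def nth_append)
      then show ?thesis
        using 4 nbrs(1) nbrs'[of x1] \<open>3 \<le> k\<close> by simp
    qed
  qed
  moreover have "distinct xs" "set xs \<subseteq> W" "length xs = k"
    using x ys T len \<open>3 \<le> k\<close> by (auto simp: xs_def)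
  ultimately show ?thesis by blast
qed

section \<open>Three-dimensional grids\<close>

abbreviation grid :: "nat \<Rightarrow> nat \<Rightarrow> nat \<Rightarrow> ((nat \<times> nat) \<times> nat) pair_pre_digraph" where
  "grid n1 n2 n3 \<equiv> path_graph n1 \<box> path_graph n2 \<box> path_graph n3"

lemma grid_arcD:
  assumes "(((a, b), c), ((a', b'), c')) \<in> parcs (grid n1 n2 n3)"
  shows "a' = a \<and> b' = b \<and> (c' = c + 1 \<or> c = c' + 1) \<or>
    a' = a \<and> c' = c \<and> (b' = b + 1 \<or> b = b' + 1) \<or>
    b' = b \<and> c' = c \<and> (a' = a + 1 \<or> a = a' + 1)"
  using assms by (simp add: cartesian_product_def path_graph_def) blast

text \<open>
  Truncated subtraction on the boundary does no harm here: the bounds are only supersets.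
\<close>

lemma grid_nbrs:
  "{y. (((a, b), c), y) \<in> parcs (grid n1 n2 n3)} \<subseteq>
     {((a - 1, b), c), ((a + 1, b), c), ((a, b - 1), c), ((a, b + 1), c),
      ((a, b), c - 1), ((a, b), c + 1)}"
proof
  fix y
  assume y: "y \<in> {y. (((a, b), c), y) \<in> parcs (grid n1 n2 n3)}"
  obtain a' b' c' where eq: "y = ((a', b'), c')"
    by (cases y, cases "fst y") auto
  have "(((a, b), c), ((a', b'), c')) \<in> parcs (grid n1 n2 n3)"
    using y eq by simp
  from grid_arcD[OF this] y
  show "y \<in> {((a - 1, b), c), ((a + 1, b), c), ((a, b - 1), c), ((a, b + 1), c),
      ((a, b), c - 1), ((a, b), c + 1)}"
    by (elim disjE conjE) (simp_all add: eq less_eq_prod_def less_prod_def)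
qed

text \<open>Raising one coordinate makes a point lexicographically larger, so only the three
  neighbours with a lowered coordinate remain.\<close>

lemma grid_nbrs_below:
  "{y. (((a, b), c), y) \<in> parcs (grid n1 n2 n3) \<and> y \<le> ((a, b), c)} \<subseteq>
     {((a - 1, b), c), ((a, b - 1), c), ((a, b), c - 1)}"
proof
  fix y
  assume y: "y \<in> {y. (((a, b), c), y) \<in> parcs (grid n1 n2 n3) \<and> y \<le> ((a, b), c)}"
  obtain a' b' c' where eq: "y = ((a', b'), c')"
    by (cases y, cases "fst y") auto
  have "(((a, b), c), ((a', b'), c')) \<in> parcs (grid n1 n2 n3)"
    using y eq by simp
  from grid_arcD[OF this] y
  show "y \<in> {((a - 1, b), c), ((a, b - 1), c), ((a, b), c - 1)}"
    by (elim disjE conjE) (simp_all add: eq less_eq_prod_def less_prod_def)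
qed

lemma card_grid_nbrs: "card {y \<in> A. (x, y) \<in> parcs (grid n1 n2 n3)} \<le> 6"
proof -
  obtain a b c where x: "x = ((a, b), c)"
    by (cases x, cases "fst x") auto
  let ?N = "{((a - 1, b), c), ((a + 1, b), c), ((a, b - 1), c), ((a, b + 1), c),
    ((a, b), c - 1), ((a, b), c + 1)}"
  have "{y \<in> A. (x, y) \<in> parcs (grid n1 n2 n3)} \<subseteq> ?N"
    using grid_nbrs[of a b c n1 n2 n3] unfolding x by blast
  then have "card {y \<in> A. (x, y) \<in> parcs (grid n1 n2 n3)} \<le> card ?N"
    by (rule card_mono[rotated]) simp
  also have "\<dots> \<le> 6"
    by (simp add: card_insert_if)
  finally show ?thesis .
qed

lemma card_grid_nbrs_below:
  assumes "\<And>y. y \<in> A \<Longrightarrow> y \<le> x"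
  shows "card {y \<in> A. (x, y) \<in> parcs (grid n1 n2 n3)} \<le> 3"
proof -
  obtain a b c where x: "x = ((a, b), c)"
    by (cases x, cases "fst x") auto
  let ?N = "{((a - 1, b), c), ((a, b - 1), c), ((a, b), c - 1)}"
  have "{y \<in> A. (x, y) \<in> parcs (grid n1 n2 n3)} \<subseteq> ?N"
    using grid_nbrs_below[of a b c n1 n2 n3] assms unfolding x by blast
  then have "card {y \<in> A. (x, y) \<in> parcs (grid n1 n2 n3)} \<le> card ?N"
    by (rule card_mono[rotated]) simp
  also have "\<dots> \<le> 3"
    by (simp add: card_insert_if)
  finally show ?thesis .
qed

lemma pair_graph_grid: "pair_graph (grid n1 n2 n3)"
  by (intro pair_graph_cartesian_product pair_graph_path_graph)

lemma sym_grid: "sym (parcs (grid n1 n2 n3))"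
proof -
  interpret pair_graph "grid n1 n2 n3" by (rule pair_graph_grid)
  show ?thesis using pair_sym_arcs by (simp add: symmetric_def)
qed

lemma irrefl_grid: "irrefl (parcs (grid n1 n2 n3))"
proof -
  interpret pair_graph "grid n1 n2 n3" by (rule pair_graph_grid)
  show ?thesis using pair_no_loops by (fastforce simp: irrefl_def)
qed

lemma grid_removable_triple:
  fixes W :: "((nat \<times> nat) \<times> nat) set"
  assumes fin: "finite W" and card: "3 \<le> card W"
  shows "\<exists>x1 x2 x3. x1 \<in> W \<and> x2 \<in> W \<and> x3 \<in> W \<and> distinct [x1, x2, x3] \<and>
    card {y \<in> W - {x1, x2, x3}. (x1, y) \<in> parcs (grid n1 n2 n3)} < 2 \<and>
    card {y \<in> W - {x1, x2, x3}. (x2, y) \<in> parcs (grid n1 n2 n3)} < 4 \<and>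
    card {y \<in> W - {x1, x2, x3}. (x3, y) \<in> parcs (grid n1 n2 n3)} < 6"
proof -
  let ?E = "parcs (grid n1 n2 n3)"
  \<comment> \<open>Guarantees that each \<open>Max\<close> below is taken over a nonempty
    set.\<close>
  have nonempty: "W - {x, y} \<noteq> {}" for x y
    using card card_mono[of "{x, y}" W] by (auto simp: card_insert_if split: if_splits)
  define v where "v = Max W"
  have "v \<in> W"
    unfolding v_def using fin nonempty by (intro Max_in) auto
  have v_max: "y \<le> v" if "y \<in> W" for y
    using that fin by (simp add: v_def)
  obtain a b c where v: "v = ((a, b), c)"
    by (cases v, cases "fst v") auto
  define w where "w = ((a, b - 1), c)"
  define x2 where "x2 = Max (W - {v, w})"
  have x2: "x2 \<in> W - {v, w}"
    unfolding x2_def using fin nonempty by (intro Max_in) auto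
  have x2_max: "y \<le> x2" if "y \<in> W - {v, w}" for y
    using that fin by (simp add: x2_def)
  \<comment> \<open>If \<open>b = 0\<close>, truncated subtraction makes \<open>w\<close> equal to
    \<open>v\<close>; testing membership in \<open>W - {v}\<close> rules this out.\<close>
  define x3 where "x3 = (if w \<in> W - {v} then w else Max (W - {v, x2}))"
  have Max_in_rest: "Max (W - {v, x2}) \<in> W - {v, x2}"
    using fin nonempty by (intro Max_in) auto
  have x3: "x3 \<in> W - {v, x2}"
    using x2 Max_in_rest by (auto simp: x3_def)
  let ?R = "W - {v, x2, x3}"
  have "w \<notin> ?R"
    by (auto simp: x3_def)
  \<comment> \<open>No point lies strictly between \<open>((a, b), c - 1)\<close> and
    \<open>v\<close>, so this point, if left over, would have been chosen as
    \<open>x2\<close>.\<close>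
  have u: "((a, b), c - 1) \<notin> ?R"
  proof
    assume u: "((a, b), c - 1) \<in> ?R"
    then have "((a, b), c - 1) \<le> x2"
      using \<open>w \<notin> ?R\<close> by (intro x2_max) auto
    moreover have "x2 \<le> ((a, b), c)" "x2 \<noteq> ((a, b), c)"
      using x2 v_max v by auto
    ultimately have "x2 = ((a, b), c - 1)"
      by (cases x2) (auto simp: less_eq_prod_def less_prod_def)
    then show False
      using u by simp
  qed
  have "card {y \<in> ?R. (v, y) \<in> ?E} \<le> card {((a - 1, b), c)}"
  proof (rule card_mono)
    show "{y \<in> ?R. (v, y) \<in> ?E} \<subseteq> {((a - 1, b), c)}"
      using grid_nbrs_below[of a b c n1 n2 n3] v_max u \<open>w \<notin> ?R\<close> unfolding v w_def by blast
  qed simp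
  moreover have "card {y \<in> ?R. (x2, y) \<in> ?E} \<le> 3"
    using x2_max \<open>w \<notin> ?R\<close> by (intro card_grid_nbrs_below) auto
  moreover have "card {y \<in> ?R. (x3, y) \<in> ?E} < 6"
  proof (cases "w \<in> W - {v}")
    case True
    \<comment> \<open>Here \<open>w\<close> differs from \<open>v\<close>, so \<open>b\<close> is
      positive and \<open>v\<close> is the neighbour of \<open>w\<close> with raised second
      coordinate. Its removal leaves at most five.\<close>
    then have "x3 = w" "b - 1 + 1 = b"
      by (auto simp: x3_def w_def v)
    let ?N = "{((a - 1, b - 1), c), ((a + 1, b - 1), c), ((a, b - 1 - 1), c),
      ((a, b - 1), c - 1), ((a, b - 1), c + 1)}"
    have "{y \<in> ?R. (w, y) \<in> ?E} \<subseteq> ?N"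
      using grid_nbrs[of a "b - 1" c n1 n2 n3] unfolding v w_def \<open>b - 1 + 1 = b\<close> by blast
    then have "card {y \<in> ?R. (w, y) \<in> ?E} \<le> card ?N"
      by (rule card_mono[rotated]) simp
    also have "\<dots> \<le> 5"
      by (simp add: card_insert_if)
    finally show ?thesis
      using \<open>x3 = w\<close> by simp
  next
    case False
    then have "x3 = Max (W - {v, x2})"
      unfolding x3_def by (rule if_not_P)
    then have "card {y \<in> ?R. (x3, y) \<in> ?E} \<le> 3"
      using fin by (intro card_grid_nbrs_below) auto
    then show ?thesis by simp
  qed
  ultimately show ?thesis
    using \<open>v \<in> W\<close> x2 x3 by (intro exI[of _ v] exI[of _ x2] exI[of _ x3]) auto
qed

lemma grid_removable_list:
  fixes W :: "((nat \<times> nat) \<times> nat) set"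
  assumes "finite W" and "3 \<le> k" "k \<le> card W"
  shows "\<exists>xs. distinct xs \<and> set xs \<subseteq> W \<and> length xs = k \<and>
    (\<forall>i < k. 2 * i + card {y \<in> W - set xs. (xs ! i, y) \<in> parcs (grid n1 n2 n3)} < 2 * k)"
  using grid_removable_triple[OF assms(1) order_trans[OF assms(2,3)], of n1 n2 n3]
  by (elim exE conjE) (rule removable_list_of_triple[OF assms card_grid_nbrs])

text \<open>Stated for an arbitrary finite \<open>W\<close>, since removing vertices destroys the
  box shape.\<close>

lemma grid_balanced_colouring:
  assumes "3 \<le> k" and "finite W" and "\<And>v. v \<in> W \<Longrightarrow> finite (L v) \<and> card (L v) = k"
    and "card W \<le> m * k"
  shows "\<exists>c. balanced_colouring (grid n1 n2 n3) L m W c"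
  using assms(2-4)
proof (induction m arbitrary: W)
  case 0
  then show ?case
    by (simp add: balanced_colouring_empty)
next
  case (Suc m)
  let ?E = "parcs (grid n1 n2 n3)"
  obtain xs where xs: "distinct xs" "set xs \<subseteq> W" "card (W - set xs) \<le> m * k"
    and nbrs: "\<And>i. i < length xs \<Longrightarrow> 2 * i + card {y \<in> W - set xs. (xs ! i, y) \<in> ?E} < 2 * k"
  proof (cases "k \<le> card W")
    case True
    then obtain xs where "distinct xs" "set xs \<subseteq> W" "length xs = k"
      "\<forall>i < k. 2 * i + card {y \<in> W - set xs. (xs ! i, y) \<in> ?E} < 2 * k"
      using grid_removable_list[OF Suc.prems(1) assms(1)] by blast
    moreover from this have "card (W - set xs) \<le> m * k"
      using Suc.prems(3) by (subst card_Diff_subset) (auto simp: distinct_card)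
    ultimately show ?thesis
      using that[of xs] by simp
  next
    \<comment> \<open>Fewer than \<open>k\<close> points are all removed at once: no neighbours
      remain outside, and \<open>i < k\<close> is enough.\<close>
    case False
    obtain xs where "set xs = W" "distinct xs"
      using finite_distinct_list[OF Suc.prems(1)] by blast
    then show ?thesis
      using that[of xs] False distinct_card[of xs] by simp
  qed
  obtain c where c: "balanced_colouring (grid n1 n2 n3) L m (W - set xs) c"
    using Suc.IH[of "W - set xs"] Suc.prems xs(3) by blast
  show ?case
    using balanced_colouring_extend[OF sym_grid irrefl_grid Suc.prems(1,2) xs(1,2) nbrs c] by blast
qed

theorem theorem9:
  fixes n1 n2 n3 k :: nat
  assumes "n1 \<ge> 1" and "n2 \<ge> 1" and "n3 \<ge> 1"
    and "k \<ge> 3"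
  shows "equitably_list_arborable TYPE('c) k (path_graph n1 \<box> path_graph n2 \<box> path_graph n3)"
  unfolding equitably_list_arborable_def
proof (intro allI impI)
  fix L :: "(nat \<times> nat) \<times> nat \<Rightarrow> 'c set"
  let ?G = "grid n1 n2 n3"
  define q where "q = \<lceil>real (card (pverts ?G)) / real k\<rceil>"
  assume "uniform_list_assignment k ?G L"
  then have L: "\<And>v. v \<in> pverts ?G \<Longrightarrow> finite (L v) \<and> card (L v) = k"
    by (simp add: uniform_list_assignment_def)
  have fin: "finite (pverts ?G)"
    by (simp add: cartesian_product_def path_graph_def)
  have "0 \<le> real (card (pverts ?G)) / real k"
    by simp
  \<comment> \<open>Nonnegativity makes \<open>nat q\<close> equal to the integer ceiling, so
    \<open>nat q\<close> can serve as the number of induction steps and as the class bound.\<close>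
  then have "0 \<le> q"
    unfolding q_def zero_le_ceiling by linarith
  then have "real (card (pverts ?G)) / real k \<le> real (nat q)"
    unfolding q_def by simp
  then have "real (card (pverts ?G)) \<le> real (nat q * k)"
    using \<open>k \<ge> 3\<close> by (simp add: field_simps)
  then have "card (pverts ?G) \<le> nat q * k"
    by (simp only: of_nat_le_iff)
  then obtain c where "balanced_colouring ?G L (nat q) (pverts ?G) c"
    using grid_balanced_colouring[where L = L, OF \<open>k \<ge> 3\<close> fin L] by blast
  then have "list_colouring ?G L c \<and> equitable k ?G c \<and>
      (\<forall>z. acyclic_graph (with_proj ?G \<restriction> colour_class ?G c z))"
    using \<open>0 \<le> q\<close>
    by (simp add: balanced_colouring_def list_colouring_def equitable_def colour_class_def
        q_def[symmetric] le_nat_iff)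
  then show "\<exists>c. list_colouring ?G L c \<and> equitable k ?G c \<and>
      (\<forall>z. acyclic_graph (with_proj ?G \<restriction> colour_class ?G c z))"
    by blast
qed

end
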